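(* Let $\mathcal{A}$ be an abelian category with all small products and coproducts and let $\mathcal{C}$ be a class of objects of $\mathcal{A}$. The class of all $\mathcal{C}$-compact objects is closed under finite direct sums and under all cokernels of morphisms $\alpha\in\mathcal{A}(M,C)$ where $C$ is $\mathcal{C}$-compact and $M$ is an arbitrary object of $\mathcal{A}$.
   Context: A family (or system) of objects is a set-indexed family; repetitions are allowed. $\mathcal{A}(X,Y)$ denotes the abelian group of morphisms $X\to Y$. For a family $\mathcal{N}$ of objects, $\nu_N: N\to\bigoplus\mathcal{N}$ ($N\in\mathcal{N}$) are the structural morphisms of the coproduct. For an object $M$, there is the canonical (injective) group homomorphism $$\Psi_{\mathcal{N}}:\bigoplus_{N\in\mathcal{N}}\mathcal{A}(M,N)\to\mathcal{A}\Big(M,\bigoplus\mathcal{N}\Big),\qquad (\varphi_N)_N\mapsto\sum_N \nu_N\circ\varphi_N$$ (a finite sum). The object $M$ is $\mathcal{C}$-compact if $\Psi_{\mathcal{N}}$ is an isomorphism for every family $\mathcal{N}$ of objects of $\mathcal{C}$. *)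

theory Defs
  imports "HOL-Algebra.Product_Groups" "HOL-Algebra.FiniteProduct"
begin

section \<open>Preadditive and abelian categories\<close>

text \<open>
  The morphisms \<open>X \<rightarrow> Y\<close> form the carrier of the abelian group \<open>Hom A X Y\<close>. The groups of
  HOL-Algebra are written multiplicatively, so in \<open>Hom A X Y\<close> the sum of \<open>f\<close> and \<open>g\<close> is
  \<open>f \<otimes> g\<close> and the zero morphism is \<open>\<one>\<close>. Composition of morphisms is \<open>g \<cdot> f\<close> (first \<open>f\<close>).
\<close>

record ('o, 'm) cat =
  Obj  :: "'o set"
  Hom  :: "'o \<Rightarrow> 'o \<Rightarrow> 'm monoid"
  Comp :: "'m \<Rightarrow> 'm \<Rightarrow> 'm"  (infixr "\<cdot>\<index>" 75)
  Idn  :: "'o \<Rightarrow> 'm"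

abbreviation arrows :: "('o, 'm) cat \<Rightarrow> 'o \<Rightarrow> 'o \<Rightarrow> 'm set"
  where "arrows A X Y \<equiv> carrier (Hom A X Y)"

abbreviation zero_arrow :: "('o, 'm) cat \<Rightarrow> 'o \<Rightarrow> 'o \<Rightarrow> 'm"
  where "zero_arrow A X Y \<equiv> \<one>\<^bsub>Hom A X Y\<^esub>"

locale preadditive_category =
  fixes A :: "('o, 'm) cat" (structure)
  assumes Hom_disjoint:
      "\<lbrakk>X \<in> Obj A; Y \<in> Obj A; X' \<in> Obj A; Y' \<in> Obj A;
        f \<in> arrows A X Y; f \<in> arrows A X' Y'\<rbrakk> \<Longrightarrow> X = X' \<and> Y = Y'"
    and Comp_closed:
      "\<lbrakk>X \<in> Obj A; Y \<in> Obj A; Z \<in> Obj A; f \<in> arrows A X Y; g \<in> arrows A Y Z\<rbrakk>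
        \<Longrightarrow> g \<cdot> f \<in> arrows A X Z"
    and Comp_assoc:
      "\<lbrakk>W \<in> Obj A; X \<in> Obj A; Y \<in> Obj A; Z \<in> Obj A;
        f \<in> arrows A W X; g \<in> arrows A X Y; h \<in> arrows A Y Z\<rbrakk>
        \<Longrightarrow> (h \<cdot> g) \<cdot> f = h \<cdot> (g \<cdot> f)"
    and Idn_closed: "X \<in> Obj A \<Longrightarrow> Idn A X \<in> arrows A X X"
    and Comp_Idn_right:
      "\<lbrakk>X \<in> Obj A; Y \<in> Obj A; f \<in> arrows A X Y\<rbrakk> \<Longrightarrow> f \<cdot> Idn A X = f"
    and Comp_Idn_left:
      "\<lbrakk>X \<in> Obj A; Y \<in> Obj A; f \<in> arrows A X Y\<rbrakk> \<Longrightarrow> Idn A Y \<cdot> f = f"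
    and Hom_comm_group:
      "\<lbrakk>X \<in> Obj A; Y \<in> Obj A\<rbrakk> \<Longrightarrow> comm_group (Hom A X Y)"
    and Comp_add_left:
      "\<lbrakk>X \<in> Obj A; Y \<in> Obj A; Z \<in> Obj A;
        f \<in> arrows A X Y; g \<in> arrows A Y Z; h \<in> arrows A Y Z\<rbrakk>
        \<Longrightarrow> (g \<otimes>\<^bsub>Hom A Y Z\<^esub> h) \<cdot> f = (g \<cdot> f) \<otimes>\<^bsub>Hom A X Z\<^esub> (h \<cdot> f)"
    and Comp_add_right:
      "\<lbrakk>X \<in> Obj A; Y \<in> Obj A; Z \<in> Obj A;
        f \<in> arrows A X Y; g \<in> arrows A X Y; h \<in> arrows A Y Z\<rbrakk>
        \<Longrightarrow> h \<cdot> (f \<otimes>\<^bsub>Hom A X Y\<^esub> g) = (h \<cdot> f) \<otimes>\<^bsub>Hom A X Z\<^esub> (h \<cdot> g)"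

definition is_zero_object :: "('o, 'm) cat \<Rightarrow> 'o \<Rightarrow> bool"
  where "is_zero_object A Z \<longleftrightarrow> Z \<in> Obj A \<and>
    (\<forall>X \<in> Obj A. (\<exists>!f. f \<in> arrows A X Z) \<and> (\<exists>!f. f \<in> arrows A Z X))"

definition is_binary_biproduct ::
    "('o, 'm) cat \<Rightarrow> 'o \<Rightarrow> 'o \<Rightarrow> 'o \<Rightarrow> 'm \<Rightarrow> 'm \<Rightarrow> 'm \<Rightarrow> 'm \<Rightarrow> bool"
  where "is_binary_biproduct A X Y B i j p q \<longleftrightarrow>
    B \<in> Obj A \<and> i \<in> arrows A X B \<and> j \<in> arrows A Y B \<and> p \<in> arrows A B X \<and> q \<in> arrows A B Y \<and>
    p \<cdot>\<^bsub>A\<^esub> i = Idn A X \<and> q \<cdot>\<^bsub>A\<^esub> j = Idn A Y \<and>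
    (i \<cdot>\<^bsub>A\<^esub> p) \<otimes>\<^bsub>Hom A B B\<^esub> (j \<cdot>\<^bsub>A\<^esub> q) = Idn A B"

definition is_mono :: "('o, 'm) cat \<Rightarrow> 'o \<Rightarrow> 'o \<Rightarrow> 'm \<Rightarrow> bool"
  where "is_mono A X Y f \<longleftrightarrow> f \<in> arrows A X Y \<and>
    (\<forall>W \<in> Obj A. \<forall>g \<in> arrows A W X. \<forall>h \<in> arrows A W X.
      f \<cdot>\<^bsub>A\<^esub> g = f \<cdot>\<^bsub>A\<^esub> h \<longrightarrow> g = h)"

definition is_epi :: "('o, 'm) cat \<Rightarrow> 'o \<Rightarrow> 'o \<Rightarrow> 'm \<Rightarrow> bool"
  where "is_epi A X Y f \<longleftrightarrow> f \<in> arrows A X Y \<and>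
    (\<forall>Z \<in> Obj A. \<forall>g \<in> arrows A Y Z. \<forall>h \<in> arrows A Y Z.
      g \<cdot>\<^bsub>A\<^esub> f = h \<cdot>\<^bsub>A\<^esub> f \<longrightarrow> g = h)"

text \<open>\<open>k : K \<rightarrow> X\<close> is a kernel of \<open>f : X \<rightarrow> Y\<close>.\<close>

definition is_kernel :: "('o, 'm) cat \<Rightarrow> 'o \<Rightarrow> 'o \<Rightarrow> 'm \<Rightarrow> 'o \<Rightarrow> 'm \<Rightarrow> bool"
  where "is_kernel A X Y f K k \<longleftrightarrow>
    K \<in> Obj A \<and> k \<in> arrows A K X \<and> f \<cdot>\<^bsub>A\<^esub> k = zero_arrow A K Y \<and>
    (\<forall>W \<in> Obj A. \<forall>g \<in> arrows A W X. f \<cdot>\<^bsub>A\<^esub> g = zero_arrow A W Y \<longrightarrow>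
      (\<exists>!u. u \<in> arrows A W K \<and> k \<cdot>\<^bsub>A\<^esub> u = g))"

text \<open>\<open>p : Y \<rightarrow> Q\<close> is a cokernel of \<open>f : X \<rightarrow> Y\<close>.\<close>

definition is_cokernel :: "('o, 'm) cat \<Rightarrow> 'o \<Rightarrow> 'o \<Rightarrow> 'm \<Rightarrow> 'o \<Rightarrow> 'm \<Rightarrow> bool"
  where "is_cokernel A X Y f Q p \<longleftrightarrow>
    Q \<in> Obj A \<and> p \<in> arrows A Y Q \<and> p \<cdot>\<^bsub>A\<^esub> f = zero_arrow A X Q \<and>
    (\<forall>Z \<in> Obj A. \<forall>g \<in> arrows A Y Z. g \<cdot>\<^bsub>A\<^esub> f = zero_arrow A X Z \<longrightarrow>
      (\<exists>!u. u \<in> arrows A Q Z \<and> u \<cdot>\<^bsub>A\<^esub> p = g))"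

locale abelian_category = preadditive_category +
  assumes zero_object: "\<exists>Z. is_zero_object A Z"
    and binary_biproducts:
      "\<lbrakk>X \<in> Obj A; Y \<in> Obj A\<rbrakk> \<Longrightarrow> \<exists>B i j p q. is_binary_biproduct A X Y B i j p q"
    and kernels:
      "\<lbrakk>X \<in> Obj A; Y \<in> Obj A; f \<in> arrows A X Y\<rbrakk> \<Longrightarrow> \<exists>K k. is_kernel A X Y f K k"
    and cokernels:
      "\<lbrakk>X \<in> Obj A; Y \<in> Obj A; f \<in> arrows A X Y\<rbrakk> \<Longrightarrow> \<exists>Q p. is_cokernel A X Y f Q p"
    and mono_is_kernel:
      "\<lbrakk>X \<in> Obj A; Y \<in> Obj A; is_mono A X Y f\<rbrakk>
        \<Longrightarrow> \<exists>Z g. Z \<in> Obj A \<and> g \<in> arrows A Y Z \<and> is_kernel A Y Z g X f"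
    and epi_is_cokernel:
      "\<lbrakk>X \<in> Obj A; Y \<in> Obj A; is_epi A X Y f\<rbrakk>
        \<Longrightarrow> \<exists>W g. W \<in> Obj A \<and> g \<in> arrows A W X \<and> is_cokernel A W X g Y f"


section \<open>Products and coproducts of families\<close>

text \<open>A family of objects is a map \<open>N\<close> on an index set \<open>I\<close>; it need not be injective.\<close>

definition is_product ::
    "('o, 'm) cat \<Rightarrow> 'i set \<Rightarrow> ('i \<Rightarrow> 'o) \<Rightarrow> 'o \<Rightarrow> ('i \<Rightarrow> 'm) \<Rightarrow> bool"
  where "is_product A I N P \<pi> \<longleftrightarrow>
    P \<in> Obj A \<and> (\<forall>i \<in> I. N i \<in> Obj A \<and> \<pi> i \<in> arrows A P (N i)) \<and>
    (\<forall>W \<in> Obj A. \<forall>f. (\<forall>i \<in> I. f i \<in> arrows A W (N i)) \<longrightarrow>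
      (\<exists>!u. u \<in> arrows A W P \<and> (\<forall>i \<in> I. \<pi> i \<cdot>\<^bsub>A\<^esub> u = f i)))"

definition is_coproduct ::
    "('o, 'm) cat \<Rightarrow> 'i set \<Rightarrow> ('i \<Rightarrow> 'o) \<Rightarrow> 'o \<Rightarrow> ('i \<Rightarrow> 'm) \<Rightarrow> bool"
  where "is_coproduct A I N S \<nu> \<longleftrightarrow>
    S \<in> Obj A \<and> (\<forall>i \<in> I. N i \<in> Obj A \<and> \<nu> i \<in> arrows A (N i) S) \<and>
    (\<forall>Z \<in> Obj A. \<forall>f. (\<forall>i \<in> I. f i \<in> arrows A (N i) Z) \<longrightarrow>
      (\<exists>!u. u \<in> arrows A S Z \<and> (\<forall>i \<in> I. u \<cdot>\<^bsub>A\<^esub> \<nu> i = f i)))"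

text \<open>
  A HOL statement cannot quantify over index sets of all types, so smallness is relative to a
  universe: a system \<open>\<U>\<close> of subsets of a type of indices, the small sets. For a Grothendieck
  universe, take its elements as indices and let the small sets be the sets of indices that are
  equipotent to a member of the universe.
\<close>

locale small_sets =
  fixes \<U> :: "'i set set"
  assumes infinite_indices: "infinite (UNIV :: 'i set)"
    and small_finite: "finite I \<Longrightarrow> I \<in> \<U>"
    and small_subset: "\<lbrakk>I \<in> \<U>; J \<subseteq> I\<rbrakk> \<Longrightarrow> J \<in> \<U>"
    and small_image: "I \<in> \<U> \<Longrightarrow> (h :: 'i \<Rightarrow> 'i) ` I \<in> \<U>"
    and small_Union: "\<lbrakk>I \<in> \<U>; \<And>i. i \<in> I \<Longrightarrow> F (i :: 'i) \<in> \<U>\<rbrakk> \<Longrightarrow> (\<Union>i \<in> I. F i) \<in> \<U>"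

definition has_small_products :: "('o, 'm) cat \<Rightarrow> 'i set set \<Rightarrow> bool"
  where "has_small_products A \<U> \<longleftrightarrow>
    (\<forall>I \<in> \<U>. \<forall>N \<in> I \<rightarrow> Obj A. \<exists>P \<pi>. is_product A I N P \<pi>)"

definition has_small_coproducts :: "('o, 'm) cat \<Rightarrow> 'i set set \<Rightarrow> bool"
  where "has_small_coproducts A \<U> \<longleftrightarrow>
    (\<forall>I \<in> \<U>. \<forall>N \<in> I \<rightarrow> Obj A. \<exists>S \<nu>. is_coproduct A I N S \<nu>)"


section \<open>Compact objects\<close>

text \<open>
  The map \<open>\<Psi>\<close> for the coproduct \<open>S\<close>, \<open>\<nu>\<close> of the family \<open>N\<close>. It sends \<open>\<phi>\<close>, an element of the
  direct sum of the groups \<open>Hom A M (N i)\<close>, to the sum of the \<open>\<nu> i \<cdot> \<phi> i\<close> over the finite support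
  of \<open>\<phi>\<close>; this sum is taken in \<open>Hom A M S\<close>, hence the multiplicative name \<open>finprod\<close>.
\<close>

definition \<Psi> ::
    "('o, 'm) cat \<Rightarrow> 'o \<Rightarrow> 'i set \<Rightarrow> ('i \<Rightarrow> 'o) \<Rightarrow> 'o \<Rightarrow> ('i \<Rightarrow> 'm) \<Rightarrow> ('i \<Rightarrow> 'm) \<Rightarrow> 'm"
  where "\<Psi> A M I N S \<nu> \<phi> =
    finprod (Hom A M S) (\<lambda>i. \<nu> i \<cdot>\<^bsub>A\<^esub> \<phi> i) {i \<in> I. \<phi> i \<noteq> zero_arrow A M (N i)}"

text \<open>
  \<open>sum_group\<close> is the direct sum: families of finite support. Coproducts are determined only up to
  isomorphism; the condition is imposed on every coproduct of the family.
\<close>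

definition compact_object :: "('o, 'm) cat \<Rightarrow> 'i set set \<Rightarrow> 'o set \<Rightarrow> 'o \<Rightarrow> bool"
  where "compact_object A \<U> \<C> M \<longleftrightarrow> M \<in> Obj A \<and>
    (\<forall>I \<in> \<U>. \<forall>N \<in> I \<rightarrow> \<C>. \<forall>S \<nu>. is_coproduct A I N S \<nu> \<longrightarrow>
      \<Psi> A M I N S \<nu> \<in> iso (sum_group I (\<lambda>i. Hom A M (N i))) (Hom A M S))"

end

theory Submission
  imports Defs
begin

text \<open>
  A coproduct \<open>S\<close> of a family \<open>N\<close> comes with projections \<open>proj i : S \<rightarrow> N i\<close>, and for finite
  \<open>F \<subseteq> I\<close> with the endomorphism \<open>partial_idn F\<close> of \<open>S\<close>, the sum of the \<open>\<nu> i \<cdot> proj i\<close>, \<open>i \<in> F\<close>.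
  Because of the projections \<open>\<Psi>\<close> is always an injective homomorphism, and its image consists of
  the \<open>f\<close> with \<open>partial_idn F \<cdot> f = f\<close> for some finite \<open>F\<close>. This condition on \<open>f\<close> can be tested
  after precomposition with an epimorphism, or with the finitely many injections of a finite
  coproduct, since \<open>F\<close> may be enlarged.
\<close>

section \<open>Biadditivity of composition, cancellation along cokernels and coproducts\<close>

context preadditive_category
begin

lemma zero_closed: "\<lbrakk>X \<in> Obj A; Y \<in> Obj A\<rbrakk> \<Longrightarrow> zero_arrow A X Y \<in> arrows A X Y"
  using Hom_comm_group by (simp add: comm_group_def comm_monoid_def monoid.one_closed)

text \<open>One half of biadditivity, packaged as a \<open>group_hom\<close> so that
  \<open>hom_one\<close> and \<open>hom_mult\<close> yield the rules for zero arrows and finite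
  sums.\<close>

lemma group_hom_Comp_left:
  assumes "X \<in> Obj A" "Y \<in> Obj A" "Z \<in> Obj A" "h \<in> arrows A Y Z"
  shows "group_hom (Hom A X Y) (Hom A X Z) (\<lambda>f. h \<cdot> f)"
  using assms Hom_comm_group
  by (auto simp: group_hom_def group_hom_axioms_def hom_def comm_group_def Comp_add_right
      intro: Comp_closed)

lemma group_hom_Comp_right:
  assumes "X \<in> Obj A" "Y \<in> Obj A" "Z \<in> Obj A" "f \<in> arrows A X Y"
  shows "group_hom (Hom A Y Z) (Hom A X Z) (\<lambda>h. h \<cdot> f)"
  using assms Hom_comm_group
  by (auto simp: group_hom_def group_hom_axioms_def hom_def comm_group_def Comp_add_left
      intro: Comp_closed)

lemma Comp_zero_right:
  assumes "X \<in> Obj A" "Y \<in> Obj A" "Z \<in> Obj A" "h \<in> arrows A Y Z"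
  shows "h \<cdot> zero_arrow A X Y = zero_arrow A X Z"
  using group_hom.hom_one[OF group_hom_Comp_left[OF assms]] .

lemma Comp_finprod_left:
  assumes "X \<in> Obj A" "Y \<in> Obj A" "Z \<in> Obj A" "h \<in> arrows A Y Z"
    and "finite F" "\<And>i. i \<in> F \<Longrightarrow> g i \<in> arrows A X Y"
  shows "h \<cdot> finprod (Hom A X Y) g F = finprod (Hom A X Z) (\<lambda>i. h \<cdot> g i) F"
proof -
  interpret XY: comm_group "Hom A X Y" using assms Hom_comm_group by simp
  interpret XZ: comm_group "Hom A X Z" using assms Hom_comm_group by simp
  interpret group_hom "Hom A X Y" "Hom A X Z" "\<lambda>f. h \<cdot> f"
    using assms by (simp add: group_hom_Comp_left)
  from assms(5,6) show ?thesis
    by (induction F) (simp_all add: Pi_iff)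
qed

lemma Comp_finprod_right:
  assumes "X \<in> Obj A" "Y \<in> Obj A" "Z \<in> Obj A" "f \<in> arrows A X Y"
    and "finite F" "\<And>i. i \<in> F \<Longrightarrow> g i \<in> arrows A Y Z"
  shows "finprod (Hom A Y Z) g F \<cdot> f = finprod (Hom A X Z) (\<lambda>i. g i \<cdot> f) F"
proof -
  interpret YZ: comm_group "Hom A Y Z" using assms Hom_comm_group by simp
  interpret XZ: comm_group "Hom A X Z" using assms Hom_comm_group by simp
  interpret group_hom "Hom A Y Z" "Hom A X Z" "\<lambda>h. h \<cdot> f"
    using assms by (simp add: group_hom_Comp_right)
  from assms(5,6) show ?thesis
    by (induction F) (simp_all add: Pi_iff)
qed

text \<open>Since \<open>p \<cdot> f\<close> is zero, so is \<open>(v \<cdot> p) \<cdot> f\<close>;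
  hence \<open>v \<cdot> p\<close> factors uniquely through \<open>p\<close>, and both
  \<open>u\<close> and \<open>v\<close> are such factors.\<close>

lemma is_cokernel_cancel:
  assumes "is_cokernel A X Y f Q p" "X \<in> Obj A" "Y \<in> Obj A" "Z \<in> Obj A" "f \<in> arrows A X Y"
    and "u \<in> arrows A Q Z" "v \<in> arrows A Q Z" "u \<cdot> p = v \<cdot> p"
  shows "u = v"
proof -
  have Q: "Q \<in> Obj A" and p: "p \<in> arrows A Y Q" and pf: "p \<cdot> f = zero_arrow A X Q"
    using assms(1) by (auto simp: is_cokernel_def)
  have vp: "v \<cdot> p \<in> arrows A Y Z" using Comp_closed assms Q p by blast
  have "(v \<cdot> p) \<cdot> f = zero_arrow A X Z"
    using Comp_assoc[of X Y Q Z f p v] Comp_zero_right[of X Q Z v] assms Q p pf by simp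
  then have "\<exists>!w. w \<in> arrows A Q Z \<and> w \<cdot> p = v \<cdot> p"
    using assms(1,4) vp unfolding is_cokernel_def by blast
  with assms show ?thesis by metis
qed

text \<open>The family \<open>v \<cdot> \<nu> i\<close> induces exactly one arrow out of
  \<open>S\<close>, and both \<open>u\<close> and \<open>v\<close> induce it.\<close>

lemma is_coproduct_cancel:
  assumes "is_coproduct A I N S \<nu>" "Z \<in> Obj A"
    and "u \<in> arrows A S Z" "v \<in> arrows A S Z" "\<And>i. i \<in> I \<Longrightarrow> u \<cdot> \<nu> i = v \<cdot> \<nu> i"
  shows "u = v"
proof -
  have "\<forall>i\<in>I. v \<cdot> \<nu> i \<in> arrows A (N i) Z"
    using assms(1,2,4) Comp_closed unfolding is_coproduct_def by blast
  then have "\<exists>!w. w \<in> arrows A S Z \<and> (\<forall>i\<in>I. w \<cdot> \<nu> i = v \<cdot> \<nu> i)"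
    using assms(1,2) by (simp add: is_coproduct_def)
  with assms(3-5) show ?thesis by metis
qed

end

section \<open>Projections and partial identities of a coproduct\<close>

locale preadditive_coproduct = preadditive_category A
  for A :: "('o, 'm) cat" (structure) +
  fixes I :: "'i set" and N :: "'i \<Rightarrow> 'o" and S :: 'o and \<nu> :: "'i \<Rightarrow> 'm"
  assumes coproduct: "is_coproduct A I N S \<nu>"
begin

lemma S_Obj: "S \<in> Obj A" and N_Obj: "i \<in> I \<Longrightarrow> N i \<in> Obj A"
  and inj_closed: "i \<in> I \<Longrightarrow> \<nu> i \<in> arrows A (N i) S"
  using coproduct by (auto simp: is_coproduct_def)

text \<open>A coproduct carries no projections as data. They come from its universal property,
  applied to the Kronecker delta family of identities and zero arrows.\<close>

definition proj :: "'i \<Rightarrow> 'm"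
  where "proj i = (THE u. u \<in> arrows A S (N i) \<and>
    (\<forall>j\<in>I. u \<cdot> \<nu> j = (if j = i then Idn A (N i) else zero_arrow A (N j) (N i))))"

lemma proj:
  assumes "i \<in> I"
  shows proj_closed: "proj i \<in> arrows A S (N i)"
    and proj_inj: "j \<in> I \<Longrightarrow> proj i \<cdot> \<nu> j = (if j = i then Idn A (N i) else zero_arrow A (N j) (N i))"
proof -
  let ?f = "\<lambda>j. if j = i then Idn A (N i) else zero_arrow A (N j) (N i)"
  have univ: "\<And>Z f. \<lbrakk>Z \<in> Obj A; \<forall>j\<in>I. f j \<in> arrows A (N j) Z\<rbrakk> \<Longrightarrow>
      \<exists>!u. u \<in> arrows A S Z \<and> (\<forall>j\<in>I. u \<cdot> \<nu> j = f j)"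
    using coproduct by (simp add: is_coproduct_def)
  have "\<exists>!u. u \<in> arrows A S (N i) \<and> (\<forall>j\<in>I. u \<cdot> \<nu> j = ?f j)"
    by (rule univ) (use assms in \<open>auto simp: N_Obj Idn_closed zero_closed\<close>)
  from theI'[OF this]
  show "proj i \<in> arrows A S (N i)" "j \<in> I \<Longrightarrow> proj i \<cdot> \<nu> j = ?f j"
    unfolding proj_def by blast+
qed

lemma inj_Comp_closed:
  "\<lbrakk>M \<in> Obj A; i \<in> I; f \<in> arrows A M (N i)\<rbrakk> \<Longrightarrow> \<nu> i \<cdot> f \<in> arrows A M S"
  using Comp_closed N_Obj S_Obj inj_closed by blast

lemma proj_Comp_closed:
  "\<lbrakk>M \<in> Obj A; i \<in> I; f \<in> arrows A M S\<rbrakk> \<Longrightarrow> proj i \<cdot> f \<in> arrows A M (N i)"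
  using Comp_closed N_Obj S_Obj proj_closed by blast

text \<open>For finite \<open>F \<subseteq> I\<close> this is the idempotent of \<open>S\<close>
  that projects onto the summands indexed by \<open>F\<close>. For infinite \<open>F\<close> the
  default of \<open>finprod\<close> makes it the zero arrow.\<close>

definition partial_idn :: "'i set \<Rightarrow> 'm"
  where "partial_idn F = finprod (Hom A S S) (\<lambda>i. \<nu> i \<cdot> proj i) F"

lemma inj_proj_closed: "i \<in> I \<Longrightarrow> \<nu> i \<cdot> proj i \<in> arrows A S S"
  using inj_Comp_closed S_Obj proj_closed by blast

lemma partial_idn_closed:
  assumes "F \<subseteq> I"
  shows "partial_idn F \<in> arrows A S S"
proof -
  interpret SS: comm_group "Hom A S S" using S_Obj Hom_comm_group by simp
  show ?thesis
    unfolding partial_idn_def using assms inj_proj_closed by (intro SS.finprod_closed) auto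
qed

lemma partial_idn_Comp:
  assumes "M \<in> Obj A" "f \<in> arrows A M S" "finite F" "F \<subseteq> I"
  shows "partial_idn F \<cdot> f = finprod (Hom A M S) (\<lambda>i. \<nu> i \<cdot> (proj i \<cdot> f)) F"
proof -
  interpret MS: comm_group "Hom A M S" using assms S_Obj Hom_comm_group by simp
  have "partial_idn F \<cdot> f = finprod (Hom A M S) (\<lambda>i. (\<nu> i \<cdot> proj i) \<cdot> f) F"
    unfolding partial_idn_def using assms S_Obj inj_proj_closed
    by (intro Comp_finprod_right) auto
  also have "\<dots> = finprod (Hom A M S) (\<lambda>i. \<nu> i \<cdot> (proj i \<cdot> f)) F"
    using assms Comp_assoc[OF _ S_Obj N_Obj S_Obj _ proj_closed inj_closed]
    by (intro MS.finprod_cong') (auto simp: inj_Comp_closed proj_Comp_closed)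
  finally show ?thesis .
qed

text \<open>The Kronecker relations of \<open>proj_inj\<close> kill every summand except the one
  with index \<open>k\<close>, which is present only if \<open>k\<close> lies in
  \<open>F\<close>.\<close>

lemma proj_finprod:
  assumes "M \<in> Obj A" "finite F" "F \<subseteq> I" "k \<in> I"
    and "\<And>i. i \<in> I \<Longrightarrow> \<phi> i \<in> arrows A M (N i)"
  shows "proj k \<cdot> finprod (Hom A M S) (\<lambda>i. \<nu> i \<cdot> \<phi> i) F =
    (if k \<in> F then \<phi> k else zero_arrow A M (N k))"
proof -
  interpret MN: comm_group "Hom A M (N k)" using assms N_Obj Hom_comm_group by simp
  have comp: "proj k \<cdot> (\<nu> i \<cdot> \<phi> i) = (if k = i then \<phi> k else zero_arrow A M (N k))"
    if "i \<in> I" for i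
  proof -
    have "proj k \<cdot> (\<nu> i \<cdot> \<phi> i) = (proj k \<cdot> \<nu> i) \<cdot> \<phi> i"
      using Comp_assoc[of M "N i" S "N k"] assms that N_Obj S_Obj inj_closed proj_closed by simp
    \<comment> \<open>For \<open>i = k\<close> an identity cancels; otherwise precomposition with
      \<open>\<phi> i\<close> is a homomorphism and sends the zero arrow to zero.\<close>
    then show ?thesis
      using assms that N_Obj proj_inj Comp_Idn_left
        group_hom.hom_one[OF group_hom_Comp_right[of M "N i" "N k" "\<phi> i"]]
      by simp
  qed
  have "proj k \<cdot> finprod (Hom A M S) (\<lambda>i. \<nu> i \<cdot> \<phi> i) F =
      finprod (Hom A M (N k)) (\<lambda>i. proj k \<cdot> (\<nu> i \<cdot> \<phi> i)) F"
    using assms N_Obj S_Obj proj_closed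
    by (intro Comp_finprod_left) (auto simp: inj_Comp_closed)
  also have "\<dots> = finprod (Hom A M (N k)) (\<lambda>i. if k = i then \<phi> k else zero_arrow A M (N k)) F"
    using assms comp by (intro MN.finprod_cong') auto
  also have "\<dots> = (if k \<in> F then \<phi> k else zero_arrow A M (N k))"
  proof (cases "k \<in> F")
    case True
    then show ?thesis
      using MN.finprod_singleton[of k F "\<lambda>_. \<phi> k"] assms by simp
  next
    case False
    then show ?thesis
      by (auto intro!: MN.finprod_one_eqI)
  qed
  finally show ?thesis .
qed

section \<open>Homomorphism, injectivity and image of \<open>\<Psi>\<close>\<close>

text \<open>Indices outside the support contribute zero. This frees the sum from the exact support,
  so that several families can be summed over one common index set.\<close>

lemma \<Psi>_eq_finprod:
  assumes "M \<in> Obj A" "finite F" "F \<subseteq> I"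
    and "\<And>i. i \<in> I \<Longrightarrow> \<phi> i \<in> arrows A M (N i)"
    and "\<And>i. i \<in> I - F \<Longrightarrow> \<phi> i = zero_arrow A M (N i)"
  shows "\<Psi> A M I N S \<nu> \<phi> = finprod (Hom A M S) (\<lambda>i. \<nu> i \<cdot> \<phi> i) F"
proof -
  interpret MS: comm_group "Hom A M S" using assms S_Obj Hom_comm_group by simp
  show ?thesis
    unfolding \<Psi>_def
  proof (rule MS.finprod_mono_neutral_cong_left)
    show "\<nu> i \<cdot> \<phi> i = zero_arrow A M S"
      if "i \<in> F - {i \<in> I. \<phi> i \<noteq> zero_arrow A M (N i)}" for i
      using that assms Comp_zero_right[of M "N i" S "\<nu> i"] N_Obj S_Obj inj_closed by auto
    show "(\<lambda>i. \<nu> i \<cdot> \<phi> i) \<in> F \<rightarrow> arrows A M S"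
      using assms by (auto simp: inj_Comp_closed)
  qed (use assms in auto)
qed

lemma carrier_sum_Hom:
  "M \<in> Obj A \<Longrightarrow> carrier (sum_group I (\<lambda>i. Hom A M (N i))) =
    {\<phi> \<in> \<Pi>\<^sub>E i\<in>I. arrows A M (N i). finite {i \<in> I. \<phi> i \<noteq> zero_arrow A M (N i)}}"
  using N_Obj Hom_comm_group by (intro carrier_sum_group) (blast dest: comm_group.axioms(2))

lemma \<Psi>_hom:
  assumes M: "M \<in> Obj A"
  shows "\<Psi> A M I N S \<nu> \<in> hom (sum_group I (\<lambda>i. Hom A M (N i))) (Hom A M S)"
proof (rule homI)
  let ?G = "sum_group I (\<lambda>i. Hom A M (N i))"
  let ?supp = "\<lambda>\<phi>. {i \<in> I. \<phi> i \<noteq> zero_arrow A M (N i)}"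
  interpret MS: comm_group "Hom A M S" using assms S_Obj Hom_comm_group by simp
  have grp: "group (Hom A M (N i))" if "i \<in> I" for i
    using that M N_Obj Hom_comm_group comm_group.axioms(2) by blast
  have closed: "\<nu> i \<cdot> \<phi> i \<in> arrows A M S" if "\<phi> \<in> carrier ?G" "i \<in> I" for \<phi> i
    using that M by (auto simp: carrier_sum_Hom PiE_iff inj_Comp_closed)
  show "\<Psi> A M I N S \<nu> \<phi> \<in> arrows A M S" if "\<phi> \<in> carrier ?G" for \<phi>
    unfolding \<Psi>_def using closed that by (intro MS.finprod_closed) auto
  show "\<Psi> A M I N S \<nu> (\<phi> \<otimes>\<^bsub>?G\<^esub> \<psi>) = \<Psi> A M I N S \<nu> \<phi> \<otimes>\<^bsub>Hom A M S\<^esub> \<Psi> A M I N S \<nu> \<psi>"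
    if "\<phi> \<in> carrier ?G" "\<psi> \<in> carrier ?G" for \<phi> \<psi>
  proof -
    \<comment> \<open>The supports of \<open>\<phi>\<close>, \<open>\<psi>\<close> and their sum may
      all differ, but each lies in this finite union, over which all three sums are taken.\<close>
    let ?F = "?supp \<phi> \<union> ?supp \<psi>"
    have F: "finite ?F" "?F \<subseteq> I" using that M by (auto simp: carrier_sum_Hom)
    have vals: "\<phi> i \<in> arrows A M (N i)" "\<psi> i \<in> arrows A M (N i)" if "i \<in> I" for i
      using \<open>\<phi> \<in> carrier ?G\<close> \<open>\<psi> \<in> carrier ?G\<close> that M by (auto simp: carrier_sum_Hom)
    have "\<Psi> A M I N S \<nu> (\<phi> \<otimes>\<^bsub>?G\<^esub> \<psi>) = finprod (Hom A M S) (\<lambda>i. \<nu> i \<cdot> (\<phi> \<otimes>\<^bsub>?G\<^esub> \<psi>) i) ?F"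
      using F M vals grp
      by (intro \<Psi>_eq_finprod)
        (auto simp: group.is_monoid monoid.m_closed monoid.l_one)
    also have "\<dots> = finprod (Hom A M S) (\<lambda>i. (\<nu> i \<cdot> \<phi> i) \<otimes>\<^bsub>Hom A M S\<^esub> (\<nu> i \<cdot> \<psi> i)) ?F"
      using F vals that closed M N_Obj S_Obj inj_closed
      by (intro MS.finprod_cong') (auto simp: Comp_add_right)
    also have "\<dots> = finprod (Hom A M S) (\<lambda>i. \<nu> i \<cdot> \<phi> i) ?F
        \<otimes>\<^bsub>Hom A M S\<^esub> finprod (Hom A M S) (\<lambda>i. \<nu> i \<cdot> \<psi> i) ?F"
      using F that closed by (intro MS.finprod_multf) auto
    also have "\<dots> = \<Psi> A M I N S \<nu> \<phi> \<otimes>\<^bsub>Hom A M S\<^esub> \<Psi> A M I N S \<nu> \<psi>"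
      using F M vals by (subst (1 2) \<Psi>_eq_finprod[of M ?F]) auto
    finally show ?thesis .
  qed
qed

text \<open>The coordinates of an element are recovered from its image; for \<open>k\<close> outside
  the support both sides are zero.\<close>

lemma proj_\<Psi>:
  assumes "M \<in> Obj A" "\<phi> \<in> carrier (sum_group I (\<lambda>i. Hom A M (N i)))" "k \<in> I"
  shows "proj k \<cdot> \<Psi> A M I N S \<nu> \<phi> = \<phi> k"
  unfolding \<Psi>_def using assms
  by (subst proj_finprod) (auto simp: carrier_sum_Hom PiE_iff)

lemma \<Psi>_inj:
  assumes "M \<in> Obj A"
  shows "inj_on (\<Psi> A M I N S \<nu>) (carrier (sum_group I (\<lambda>i. Hom A M (N i))))"
proof (rule inj_onI)
  fix \<phi> \<psi>
  assume *: "\<phi> \<in> carrier (sum_group I (\<lambda>i. Hom A M (N i)))"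
    "\<psi> \<in> carrier (sum_group I (\<lambda>i. Hom A M (N i)))"
    and eq: "\<Psi> A M I N S \<nu> \<phi> = \<Psi> A M I N S \<nu> \<psi>"
  have "\<phi> k = \<psi> k" if "k \<in> I" for k
    using proj_\<Psi>[OF assms *(1) that] proj_\<Psi>[OF assms *(2) that] eq by simp
  with * assms show "\<phi> = \<psi>"
    by (auto simp: carrier_sum_Hom intro: PiE_ext)
qed

lemma \<Psi>_image_iff:
  assumes M: "M \<in> Obj A" and f: "f \<in> arrows A M S"
  shows "f \<in> \<Psi> A M I N S \<nu> ` carrier (sum_group I (\<lambda>i. Hom A M (N i))) \<longleftrightarrow>
    (\<exists>F. finite F \<and> F \<subseteq> I \<and> partial_idn F \<cdot> f = f)"
proof
  assume "f \<in> \<Psi> A M I N S \<nu> ` carrier (sum_group I (\<lambda>i. Hom A M (N i)))"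
  then obtain \<phi> where \<phi>: "\<phi> \<in> carrier (sum_group I (\<lambda>i. Hom A M (N i)))"
    and f_eq: "f = \<Psi> A M I N S \<nu> \<phi>" by blast
  interpret MS: comm_group "Hom A M S" using assms S_Obj Hom_comm_group by simp
  let ?F = "{i \<in> I. \<phi> i \<noteq> zero_arrow A M (N i)}"
  have F: "finite ?F" "?F \<subseteq> I" using \<phi> M by (auto simp: carrier_sum_Hom)
  have "partial_idn ?F \<cdot> f = finprod (Hom A M S) (\<lambda>i. \<nu> i \<cdot> (proj i \<cdot> f)) ?F"
    using partial_idn_Comp[OF M f F] .
  \<comment> \<open>By \<open>proj_\<Psi>\<close>, \<open>proj i \<cdot> f\<close> is
    \<open>\<phi> i\<close>, so this is the sum that defines \<open>\<Psi>\<close> at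
    \<open>\<phi>\<close>.\<close>
  also have "\<dots> = f"
    unfolding \<Psi>_def f_eq
    using \<phi> M
    by (intro MS.finprod_cong')
      (auto simp: proj_\<Psi>[unfolded \<Psi>_def] carrier_sum_Hom PiE_iff inj_Comp_closed)
  finally show "\<exists>F. finite F \<and> F \<subseteq> I \<and> partial_idn F \<cdot> f = f" using F by blast
next
  assume "\<exists>F. finite F \<and> F \<subseteq> I \<and> partial_idn F \<cdot> f = f"
  then obtain F where F: "finite F" "F \<subseteq> I" and eq: "partial_idn F \<cdot> f = f" by blast
  interpret MS: comm_group "Hom A M S" using assms S_Obj Hom_comm_group by simp
  have pf: "proj i \<cdot> f \<in> arrows A M (N i)" if "i \<in> I" for i
    using that M f proj_Comp_closed by blast
  \<comment> \<open>The preimage consists of the coordinates of \<open>f\<close>, cut off outside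
    \<open>F\<close> to make the support finite.\<close>
  define \<phi> where "\<phi> = (\<lambda>i\<in>I. if i \<in> F then proj i \<cdot> f else zero_arrow A M (N i))"
  have "{i \<in> I. \<phi> i \<noteq> zero_arrow A M (N i)} \<subseteq> F" by (auto simp: \<phi>_def)
  then have "finite {i \<in> I. \<phi> i \<noteq> zero_arrow A M (N i)}" using F(1) by (rule finite_subset)
  moreover have "\<phi> \<in> (\<Pi>\<^sub>E i\<in>I. arrows A M (N i))"
    using M N_Obj pf by (auto simp: \<phi>_def zero_closed)
  ultimately have "\<phi> \<in> carrier (sum_group I (\<lambda>i. Hom A M (N i)))"
    using M by (simp add: carrier_sum_Hom)
  moreover have "\<Psi> A M I N S \<nu> \<phi> = finprod (Hom A M S) (\<lambda>i. \<nu> i \<cdot> \<phi> i) F"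
    using M F N_Obj pf by (intro \<Psi>_eq_finprod) (auto simp: \<phi>_def zero_closed)
  moreover have "\<dots> = finprod (Hom A M S) (\<lambda>i. \<nu> i \<cdot> (proj i \<cdot> f)) F"
    using F M pf by (intro MS.finprod_cong') (auto simp: \<phi>_def inj_Comp_closed)
  ultimately show "f \<in> \<Psi> A M I N S \<nu> ` carrier (sum_group I (\<lambda>i. Hom A M (N i)))"
    using partial_idn_Comp[OF M f F] eq by (metis imageI)
qed

text \<open>Additivity and injectivity always hold, so only surjectivity is left, and
  \<open>\<Psi>_image_iff\<close> describes the image.\<close>

lemma \<Psi>_iso_iff:
  assumes "M \<in> Obj A"
  shows "\<Psi> A M I N S \<nu> \<in> iso (sum_group I (\<lambda>i. Hom A M (N i))) (Hom A M S) \<longleftrightarrow>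
    (\<forall>f \<in> arrows A M S. \<exists>F. finite F \<and> F \<subseteq> I \<and> partial_idn F \<cdot> f = f)"
proof -
  have "\<Psi> A M I N S \<nu> ` carrier (sum_group I (\<lambda>i. Hom A M (N i))) \<subseteq> arrows A M S"
    using \<Psi>_hom[OF assms] by (auto simp: hom_def)
  then show ?thesis
    using \<Psi>_hom[OF assms] \<Psi>_inj[OF assms] \<Psi>_image_iff[OF assms]
    unfolding iso_def bij_betw_def by blast
qed

text \<open>An arrow fixed by \<open>partial_idn F\<close> has zero coordinates outside
  \<open>F\<close>, so the summands added by \<open>G\<close> vanish. This allows finitely many
  index sets to be merged into one.\<close>

lemma partial_idn_mono:
  assumes "M \<in> Obj A" "f \<in> arrows A M S" "finite G" "F \<subseteq> G" "G \<subseteq> I"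
    and eq: "partial_idn F \<cdot> f = f"
  shows "partial_idn G \<cdot> f = f"
proof -
  interpret MS: comm_group "Hom A M S" using assms S_Obj Hom_comm_group by simp
  have F: "finite F" "F \<subseteq> I" using assms finite_subset by auto
  have pf: "proj i \<cdot> f \<in> arrows A M (N i)" if "i \<in> I" for i
    using that assms proj_Comp_closed by blast
  \<comment> \<open>By \<open>eq\<close>, \<open>f\<close> is itself a sum over \<open>F\<close>, to
    which \<open>proj_finprod\<close> applies with an index outside \<open>F\<close>.\<close>
  have zero: "proj i \<cdot> f = zero_arrow A M (N i)" if "i \<in> G - F" for i
    using proj_finprod[of M F i "\<lambda>i. proj i \<cdot> f"] partial_idn_Comp[of M f F] assms F pf that
    by auto
  have "finprod (Hom A M S) (\<lambda>i. \<nu> i \<cdot> (proj i \<cdot> f)) F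
      = finprod (Hom A M S) (\<lambda>i. \<nu> i \<cdot> (proj i \<cdot> f)) G"
    using assms pf zero N_Obj S_Obj inj_closed
    by (intro MS.finprod_mono_neutral_cong_left)
      (auto simp: subset_iff Comp_zero_right inj_Comp_closed)
  then show ?thesis
    using eq partial_idn_Comp[of M f] assms F by simp
qed

end

section \<open>Closure properties of compact objects\<close>

context preadditive_category
begin

text \<open>Turns compactness into a condition on single arrows \<open>f\<close>. As the coproduct
  is bound by quantifiers here, \<open>partial_idn\<close> appears with its locale parameters
  explicit.\<close>

lemma compact_object_iff:
  assumes "\<C> \<subseteq> Obj A"
  shows "compact_object A \<U> \<C> M \<longleftrightarrow> M \<in> Obj A \<and>
    (\<forall>I \<in> \<U>. \<forall>N \<in> I \<rightarrow> \<C>. \<forall>S \<nu>. is_coproduct A I N S \<nu> \<longrightarrow>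
      (\<forall>f \<in> arrows A M S. \<exists>F. finite F \<and> F \<subseteq> I \<and>
        preadditive_coproduct.partial_idn A I N S \<nu> F \<cdot> f = f))"
proof -
  have *: "\<Psi> A M I N S \<nu> \<in> iso (sum_group I (\<lambda>i. Hom A M (N i))) (Hom A M S) \<longleftrightarrow>
      (\<forall>f \<in> arrows A M S. \<exists>F. finite F \<and> F \<subseteq> I \<and>
        preadditive_coproduct.partial_idn A I N S \<nu> F \<cdot> f = f)"
    if "M \<in> Obj A" "is_coproduct A I N S \<nu>" for I N S \<nu>
  proof -
    interpret preadditive_coproduct A I N S \<nu> by unfold_locales fact
    show ?thesis using that(1) by (rule \<Psi>_iso_iff)
  qed
  show ?thesis
    \<comment> \<open>The congruence rules \<open>conj_cong\<close> and \<open>imp_cong\<close>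
      supply the two premises of \<open>*\<close> under the quantifiers.\<close>
    unfolding compact_object_def by (intro conj_cong ball_cong iff_allI imp_cong refl *)
qed

text \<open>Each restriction \<open>f \<cdot> \<iota> j\<close> is fixed by some
  \<open>partial_idn (F j)\<close>. The union of the \<open>F j\<close> serves all \<open>j\<close>
  at once, and the injections \<open>\<iota> j\<close> jointly detect equality of arrows.\<close>

lemma compact_object_finite_coproduct:
  assumes \<C>: "\<C> \<subseteq> Obj A" and "finite J" and X: "\<And>j. j \<in> J \<Longrightarrow> compact_object A \<U> \<C> (X j)"
    and D: "is_coproduct A J X D \<iota>"
  shows "compact_object A \<U> \<C> D"
  unfolding compact_object_iff[OF \<C>]
proof (intro conjI ballI allI impI)
  show DO: "D \<in> Obj A" using D by (simp add: is_coproduct_def)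
  fix I N S \<nu> f
  assume *: "I \<in> \<U>" "N \<in> I \<rightarrow> \<C>" "is_coproduct A I N S \<nu>" and f: "f \<in> arrows A D S"
  interpret preadditive_coproduct A I N S \<nu> by unfold_locales fact
  have \<iota>: "X j \<in> Obj A" "\<iota> j \<in> arrows A (X j) D" "f \<cdot> \<iota> j \<in> arrows A (X j) S" if "j \<in> J" for j
    using that D f S_Obj Comp_closed unfolding is_coproduct_def by blast+
  have "\<exists>F. finite F \<and> F \<subseteq> I \<and> partial_idn F \<cdot> (f \<cdot> \<iota> j) = f \<cdot> \<iota> j" if "j \<in> J" for j
    using X[OF that] * \<iota>[OF that] unfolding compact_object_iff[OF \<C>] by blast
  then obtain F where F: "\<And>j. j \<in> J \<Longrightarrow> finite (F j) \<and> F j \<subseteq> I \<and>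
      partial_idn (F j) \<cdot> (f \<cdot> \<iota> j) = f \<cdot> \<iota> j"
    by metis
  \<comment> \<open>Finiteness of \<open>J\<close> makes this union finite.\<close>
  let ?G = "\<Union>j\<in>J. F j"
  have G: "finite ?G" "?G \<subseteq> I" using F \<open>finite J\<close> by auto
  have e: "partial_idn ?G \<in> arrows A S S" using partial_idn_closed G by blast
  have "partial_idn ?G \<cdot> f = f"
  proof (rule is_coproduct_cancel[OF D S_Obj _ f])
    show "partial_idn ?G \<cdot> f \<in> arrows A D S" using Comp_closed[OF DO S_Obj S_Obj f e] .
    fix j assume j: "j \<in> J"
    have "(partial_idn ?G \<cdot> f) \<cdot> \<iota> j = partial_idn ?G \<cdot> (f \<cdot> \<iota> j)"
      using Comp_assoc[of "X j" D S S] \<iota>[OF j] DO S_Obj f e by simp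
    also have "\<dots> = f \<cdot> \<iota> j"
      using partial_idn_mono[of "X j" "f \<cdot> \<iota> j" ?G "F j"] \<iota>[OF j] G F[OF j] j by blast
    finally show "(partial_idn ?G \<cdot> f) \<cdot> \<iota> j = f \<cdot> \<iota> j" .
  qed
  with G show "\<exists>F. finite F \<and> F \<subseteq> I \<and> partial_idn F \<cdot> f = f" by blast
qed

text \<open>A finite \<open>F\<close> obtained for \<open>f \<cdot> p\<close> from the compactness
  of \<open>C\<close> works for \<open>f\<close> too, since the cokernel \<open>p\<close> can be
  cancelled on the right.\<close>

lemma compact_object_cokernel:
  assumes \<C>: "\<C> \<subseteq> Obj A" and M: "M \<in> Obj A" and C: "compact_object A \<U> \<C> C"
    and \<alpha>: "\<alpha> \<in> arrows A M C" and Q: "is_cokernel A M C \<alpha> Q p"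
  shows "compact_object A \<U> \<C> Q"
  unfolding compact_object_iff[OF \<C>]
proof (intro conjI ballI allI impI)
  show QO: "Q \<in> Obj A" using Q by (simp add: is_cokernel_def)
  have CO: "C \<in> Obj A" using C by (simp add: compact_object_def)
  have p: "p \<in> arrows A C Q" using Q by (simp add: is_cokernel_def)
  fix I N S \<nu> f
  assume *: "I \<in> \<U>" "N \<in> I \<rightarrow> \<C>" "is_coproduct A I N S \<nu>" and f: "f \<in> arrows A Q S"
  interpret preadditive_coproduct A I N S \<nu> by unfold_locales fact
  have "f \<cdot> p \<in> arrows A C S" using Comp_closed[OF CO QO S_Obj p f] .
  then obtain F where F: "finite F" "F \<subseteq> I" "partial_idn F \<cdot> (f \<cdot> p) = f \<cdot> p"
    using C * unfolding compact_object_iff[OF \<C>] by blast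
  have e: "partial_idn F \<in> arrows A S S" using partial_idn_closed F by blast
  \<comment> \<open>After composition with \<open>p\<close>, associativity turns the claim into the
    equation known for \<open>f \<cdot> p\<close>.\<close>
  have "partial_idn F \<cdot> f = f"
    using F Comp_assoc[OF CO QO S_Obj S_Obj p f e] Comp_closed[OF QO S_Obj S_Obj f e]
    by (intro is_cokernel_cancel[OF Q M CO S_Obj \<alpha> _ f]) auto
  with F show "\<exists>F. finite F \<and> F \<subseteq> I \<and> partial_idn F \<cdot> f = f" by blast
qed

end

text \<open>Finite direct sums enter as coproducts of finite families; the empty family accounts for
  the zero object.\<close>

theorem lemma2p1:
  fixes A :: "('o, 'm) cat" and \<U> :: "'i set set" and \<C> :: "'o set"
  assumes "abelian_category A"
    and "small_sets \<U>"
    and "has_small_products A \<U>"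
    and "has_small_coproducts A \<U>"
    and "\<C> \<subseteq> Obj A"
  shows "(\<forall>(J :: 'j set) X D \<iota>.
            finite J \<and> (\<forall>j \<in> J. compact_object A \<U> \<C> (X j)) \<and> is_coproduct A J X D \<iota>
              \<longrightarrow> compact_object A \<U> \<C> D) \<and>
         (\<forall>M C \<alpha> Q p.
            M \<in> Obj A \<and> compact_object A \<U> \<C> C \<and> \<alpha> \<in> arrows A M C \<and> is_cokernel A M C \<alpha> Q p
              \<longrightarrow> compact_object A \<U> \<C> Q)"
proof -
  interpret abelian_category A by fact
  show ?thesis
  proof (intro conjI allI impI; elim conjE)
    fix J :: "'j set" and X D \<iota>
    assume "finite J" "\<forall>j \<in> J. compact_object A \<U> \<C> (X j)" "is_coproduct A J X D \<iota>"
    then show "compact_object A \<U> \<C> D"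
      by (intro compact_object_finite_coproduct[OF assms(5), of J \<U> X D \<iota>]) blast+
  qed (rule compact_object_cokernel[OF assms(5)])
qed

end
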